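(* Let $(S,\cdot)$ be a (discrete) semigroup, and let $\mathcal{F}$ be a family of subsets of $S$ with the Ramsey property such that $\beta(\mathcal{F})$ is a subsemigroup of $\beta S$. Let $A\subseteq S$. Consider the following statements. (1) $A$ is an essential $\mathcal{F}$-set. (2) There is a non-empty set $T$ of functions such that: (a) for all $f\in T$, $\operatorname{domain}(f)\in\omega$ and $\operatorname{range}(f)\subseteq A$; (b) for all $f\in T$ and all $x\in B_f(T)$, $B_{f^{\frown}x}(T)\subseteq x^{-1}B_f(T)$; (c) for every non-empty finite subset $F$ of $T$, $\bigcap_{f\in F}B_f(T)\in\mathcal{F}$. (3) There is a downward directed family $\langle C_F\rangle_{F\in I}$ of subsets of $A$ such that: (a) for each $F\in I$ and each $x\in C_F$ there exists $G\in I$ with $C_G\subseteq x^{-1}C_F$; (b) for every non-empty finite subset $H$ of $I$, $\bigcap_{F\in H}C_F\in\mathcal{F}$. (4) There is a decreasing sequence $\langle C_n\rangle_{n=1}^{\infty}$ of subsets of $A$ such that: (a) for each $n\in\mathbb{N}$ and each $x\in C_n$ there exists $m\in\mathbb{N}$ with $C_m\subseteq x^{-1}C_n$; (b) for each $n\in\mathbb{N}$, $C_n\in\mathcal{F}$. Then statements (1), (2) and (3) are equivalent and are implied by statement (4). If $S$ is countable, then all four statements are equivalent.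
   Context: A family on $S$ is a non-empty collection $\mathcal{F}\subseteq\mathcal{P}(S)\setminus\{\emptyset\}$ that is upward hereditary: $A\in\mathcal{F}$ and $A\subseteq B\subseteq S$ imply $B\in\mathcal{F}$. Members of $\mathcal{F}$ are called $\mathcal{F}$-sets. $\mathcal{F}$ has the Ramsey property if whenever $A\in\mathcal{F}$ and $A=A_1\cup A_2$, there is $i\in\{1,2\}$ with $A_i\in\mathcal{F}$. $\beta S$ is the Stone-Čech compactification of the discrete space $S$, i.e. the set of ultrafilters on $S$, with the operation extending that of $S$ given by: $A\in p\cdot q$ if and only if $\{x\in S: x^{-1}A\in q\}\in p$, where $x^{-1}A=\{y\in S: x\cdot y\in A\}$. Put $\beta(\mathcal{F})=\{p\in\beta S: p\subseteq\mathcal{F}\}$. When $\mathcal{F}$ has the Ramsey property and $\beta(\mathcal{F})$ is a subsemigroup of $\beta S$, a set $A\subseteq S$ is an essential $\mathcal{F}$-set if $A\in p$ for some idempotent $p\in\beta(\mathcal{F})$. $\omega$ is the first infinite ordinal, and each ordinal is the set of its predecessors, so $0=\emptyset$ and $n=\{0,1,\dots,n-1\}$. If $f$ is a function with $\operatorname{domain}(f)=n\in\omega$, then $f^{\frown}x=f\cup\{(n,x)\}$ for every $x$. If $T$ is a set of functions whose domains are members of $\omega$ and $f\in T$, then $B_f(T)=\{x: f^{\frown}x\in T\}$. A family $\langle C_F\rangle_{F\in I}$ of sets indexed by a non-empty set $I$ is downward directed if for all $F,G\in I$ there is $H\in I$ with $C_H\subseteq C_F\cap C_G$. *)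

theory Defs
  imports "HOL-Library.Countable_Set"
begin

text \<open>
  The discrete semigroup \<open>S\<close> is a type of class \<open>semigroup_mult\<close>, so subsets of \<open>S\<close> are
  terms of type \<open>'a set\<close> and \<open>S\<close> itself is \<open>UNIV\<close>.
\<close>

definition is_family :: "'a set set \<Rightarrow> bool" where
  "is_family \<F> \<longleftrightarrow> \<F> \<noteq> {} \<and> {} \<notin> \<F> \<and> (\<forall>A B. A \<in> \<F> \<longrightarrow> A \<subseteq> B \<longrightarrow> B \<in> \<F>)"

definition ramsey_property :: "'a set set \<Rightarrow> bool" where
  "ramsey_property \<F> \<longleftrightarrow>
     (\<forall>A A1 A2. A \<in> \<F> \<longrightarrow> A = A1 \<union> A2 \<longrightarrow> A1 \<in> \<F> \<or> A2 \<in> \<F>)"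

definition ultrafilter :: "'a set set \<Rightarrow> bool" where
  "ultrafilter p \<longleftrightarrow>
     UNIV \<in> p \<and> {} \<notin> p \<and>
     (\<forall>A B. A \<in> p \<longrightarrow> B \<in> p \<longrightarrow> A \<inter> B \<in> p) \<and>
     (\<forall>A B. A \<in> p \<longrightarrow> A \<subseteq> B \<longrightarrow> B \<in> p) \<and>
     (\<forall>A. A \<in> p \<or> - A \<in> p)"

definition beta :: "'a set set set" where
  "beta = {p. ultrafilter p}"

text \<open>\<open>x\<^sup>-\<^sup>1A\<close>; no inverse of \<open>x\<close> is assumed to exist.\<close>

definition left_quotient :: "'a::semigroup_mult \<Rightarrow> 'a set \<Rightarrow> 'a set" where
  "left_quotient x A = {y. x * y \<in> A}"

definition beta_mult :: "'a::semigroup_mult set set \<Rightarrow> 'a set set \<Rightarrow> 'a set set"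
    (infixl "\<odot>" 70) where
  "p \<odot> q = {A. {x. left_quotient x A \<in> q} \<in> p}"

definition beta_of :: "'a set set \<Rightarrow> 'a set set set" where
  "beta_of \<F> = {p \<in> beta. p \<subseteq> \<F>}"

definition beta_subsemigroup :: "'a::semigroup_mult set set set \<Rightarrow> bool" where
  "beta_subsemigroup P \<longleftrightarrow>
     P \<noteq> {} \<and> P \<subseteq> beta \<and> (\<forall>p\<in>P. \<forall>q\<in>P. p \<odot> q \<in> P)"

definition essential_set :: "'a::semigroup_mult set set \<Rightarrow> 'a set \<Rightarrow> bool" where
  "essential_set \<F> A \<longleftrightarrow> (\<exists>p\<in>beta_of \<F>. p \<odot> p = p \<and> A \<in> p)"

text \<open>
  A function whose domain is \<open>n = {0, \<dots>, n - 1}\<close> is a partial map \<open>f\<close> with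
  \<open>dom f = {..<n}\<close>; then \<open>n\<close> is recovered as \<open>card (dom f)\<close>.
\<close>

definition extend :: "(nat \<rightharpoonup> 'a) \<Rightarrow> 'a \<Rightarrow> (nat \<rightharpoonup> 'a)" where
  "extend f x = f(card (dom f) \<mapsto> x)"

definition branch :: "(nat \<rightharpoonup> 'a) set \<Rightarrow> (nat \<rightharpoonup> 'a) \<Rightarrow> 'a set" where
  "branch T f = {x. extend f x \<in> T}"

definition tree_condition ::
    "'a::semigroup_mult set set \<Rightarrow> 'a set \<Rightarrow> (nat \<rightharpoonup> 'a) set \<Rightarrow> bool" where
  "tree_condition \<F> A T \<longleftrightarrow>
     T \<noteq> {} \<and>
     (\<forall>f\<in>T. (\<exists>n. dom f = {..<n}) \<and> ran f \<subseteq> A) \<and>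
     (\<forall>f\<in>T. \<forall>x\<in>branch T f. branch T (extend f x) \<subseteq> left_quotient x (branch T f)) \<and>
     (\<forall>F. F \<noteq> {} \<longrightarrow> finite F \<longrightarrow> F \<subseteq> T \<longrightarrow> (\<Inter>f\<in>F. branch T f) \<in> \<F>)"

definition downward_directed :: "'i set \<Rightarrow> ('i \<Rightarrow> 'a set) \<Rightarrow> bool" where
  "downward_directed I C \<longleftrightarrow>
     I \<noteq> {} \<and> (\<forall>F\<in>I. \<forall>G\<in>I. \<exists>H\<in>I. C H \<subseteq> C F \<inter> C G)"

definition directed_condition ::
    "'a::semigroup_mult set set \<Rightarrow> 'a set \<Rightarrow> 'i set \<Rightarrow> ('i \<Rightarrow> 'a set) \<Rightarrow> bool" where
  "directed_condition \<F> A I C \<longleftrightarrow>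
     downward_directed I C \<and>
     (\<forall>F\<in>I. C F \<subseteq> A) \<and>
     (\<forall>F\<in>I. \<forall>x\<in>C F. \<exists>G\<in>I. C G \<subseteq> left_quotient x (C F)) \<and>
     (\<forall>H. H \<noteq> {} \<longrightarrow> finite H \<longrightarrow> H \<subseteq> I \<longrightarrow> (\<Inter>F\<in>H. C F) \<in> \<F>)"

text \<open>The sequence is indexed from 1; the value \<open>C 0\<close> is irrelevant.\<close>

definition sequence_condition ::
    "'a::semigroup_mult set set \<Rightarrow> 'a set \<Rightarrow> (nat \<Rightarrow> 'a set) \<Rightarrow> bool" where
  "sequence_condition \<F> A C \<longleftrightarrow>
     antimono_on {1..} C \<and>
     (\<forall>n\<ge>1. C n \<subseteq> A) \<and>
     (\<forall>n\<ge>1. \<forall>x\<in>C n. \<exists>m\<ge>1. C m \<subseteq> left_quotient x (C n)) \<and>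
     (\<forall>n\<ge>1. C n \<in> \<F>)"

text \<open>
  An existential quantifier cannot range over index types, so the existence of a family
  satisfying \<open>directed_condition\<close> has to name one. Index sets \<open>I :: 'a set set\<close> lose nothing:
  any \<open>C\<close> on \<open>J :: 'i set\<close> may be replaced by the identity on \<open>C ` J\<close>. A theorem drawing a
  conclusion from such a family can still do so for an arbitrary index type \<open>'i\<close>.
\<close>

end

theory Submission
  imports Defs
begin

text \<open>
  Closed subsets of \<open>\<beta>S\<close> are the sets \<open>{p. \<Phi> \<subseteq> p}\<close>, and compactness is the statement that such a
  set is non-empty as soon as \<open>\<Phi>\<close> has the finite intersection property. The Ramsey property makes
  \<open>\<beta>(\<F>)\<close> closed, because \<open>p \<subseteq> \<F>\<close> says that \<open>p\<close> contains the complement of every set outside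
  \<open>\<F>\<close>. The sets of a family as in (3) then cut out of \<open>\<beta>(\<F>)\<close> a non-empty closed subsemigroup, which
  contains an idempotent by the Ellis--Numakura theorem. Conversely, given an idempotent \<open>p\<close>
  containing \<open>A\<close>, the sets \<open>B \<in> p\<close> with \<open>B \<subseteq> A\<close> and \<open>x\<^sup>-\<^sup>1B \<in> p\<close> for all \<open>x \<in> B\<close> are stable under
  \<open>B \<mapsto> B \<inter> x\<^sup>-\<^sup>1B\<close> for \<open>x \<in> B\<close>. They form the family of (3), and iterating this step gives the branching
  sets of the tree of (2). If \<open>S\<close> is countable then so is the tree, and the intersections of initial
  segments of an enumeration of its branching sets form the sequence of (4).
\<close>

section \<open>Ultrafilters and the finite intersection property\<close>

definition fip :: "'a set set \<Rightarrow> bool" where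
  "fip \<Phi> \<longleftrightarrow> (\<forall>F. finite F \<longrightarrow> F \<subseteq> \<Phi> \<longrightarrow> \<Inter>F \<noteq> {})"

text \<open>The set \<open>\<Phi>\<close> serves as a code for a closed set: inclusion is reversed,
  and a union of codes gives the intersection of the closed sets.\<close>

definition ultrafilters_above :: "'a set set \<Rightarrow> 'a set set set" where
  "ultrafilters_above \<Phi> = {p \<in> beta. \<Phi> \<subseteq> p}"

lemma
  assumes "p \<in> beta"
  shows beta_UNIV: "UNIV \<in> p" and beta_empty: "{} \<notin> p"
    and beta_Int: "A \<in> p \<Longrightarrow> B \<in> p \<Longrightarrow> A \<inter> B \<in> p"
    and beta_mono: "A \<in> p \<Longrightarrow> A \<subseteq> B \<Longrightarrow> B \<in> p"
    and beta_Compl: "- A \<in> p \<longleftrightarrow> A \<notin> p"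
proof -
  have p: "ultrafilter p" using assms by (simp add: beta_def)
  show "UNIV \<in> p" and e: "{} \<notin> p"
    and i: "A \<in> p \<Longrightarrow> B \<in> p \<Longrightarrow> A \<inter> B \<in> p" for A B
    using p by (auto simp: ultrafilter_def)
  show "A \<in> p \<Longrightarrow> A \<subseteq> B \<Longrightarrow> B \<in> p" for A B
    using p unfolding ultrafilter_def by blast
  have "A \<in> p \<or> - A \<in> p" using p by (simp add: ultrafilter_def)
  then show "- A \<in> p \<longleftrightarrow> A \<notin> p" using i[of A "- A"] e by auto
qed

lemma beta_Inter:
  assumes "p \<in> beta" "finite F" "F \<subseteq> p"
  shows "\<Inter>F \<in> p"
  using assms(2,3)
  by (induction F rule: finite_induct) (auto intro: beta_UNIV beta_Int assms(1))

lemma beta_eqI: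
  assumes "p \<in> beta" "q \<in> beta" "p \<subseteq> q"
  shows "p = q"
  using assms beta_Compl[of p] beta_Compl[of q] by blast

lemma fip_beta: "p \<in> beta \<Longrightarrow> fip p"
  unfolding fip_def using beta_Inter beta_empty by metis

lemma fip_mono: "fip \<Psi> \<Longrightarrow> \<Phi> \<subseteq> \<Psi> \<Longrightarrow> fip \<Phi>"
  unfolding fip_def by blast

text \<open>No finite subset of \<open>p\<close> has empty intersection. The given sets together
  with the complement of the wanted one would form such a subset, so \<open>dec\<close> must put the
  wanted set into \<open>p\<close>.\<close>

lemma betaI:
  assumes fip: "fip p" and dec: "\<And>A. A \<in> p \<or> - A \<in> p"
  shows "p \<in> beta"
proof -
  have disj: False if "finite F" "F \<subseteq> p" "\<Inter>F = {}" for F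
    using fip that unfolding fip_def by blast
  have e: "{} \<notin> p" using disj[of "{{}}"] by auto
  moreover have "UNIV \<in> p" using dec[of UNIV] e by simp
  moreover have "A \<inter> B \<in> p" if "A \<in> p" "B \<in> p" for A B
    using dec[of "A \<inter> B"] disj[of "{A, B, - (A \<inter> B)}"] that by auto
  moreover have "B \<in> p" if "A \<in> p" "A \<subseteq> B" for A B
    using dec[of B] disj[of "{A, - B}"] that by auto
  ultimately show ?thesis
    unfolding beta_def ultrafilter_def using dec by auto
qed

text \<open>Members of a chain are nested, so finitely many elements of its union lie in a single
  member. This makes Zorn's lemma available for \<open>fip\<close>.\<close>

lemma fip_chain_Union:
  assumes "subset.chain {\<Phi>. fip \<Phi>} \<C>" "\<C> \<noteq> {}"
  shows "fip (\<Union>\<C>)"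
  unfolding fip_def
proof (intro allI impI)
  fix F assume "finite F" "F \<subseteq> \<Union>\<C>"
  then obtain \<Phi> where "\<Phi> \<in> \<C>" "F \<subseteq> \<Phi>"
    using finite_subset_Union_chain[OF _ _ assms(2,1)] by metis
  then show "\<Inter>F \<noteq> {}"
    using assms(1) \<open>finite F\<close> unfolding subset.chain_def fip_def by blast
qed

lemma ex_ultrafilter_above:
  assumes "fip \<Phi>"
  obtains p where "p \<in> ultrafilters_above \<Phi>"
proof -
  have "\<exists>p\<in>{\<Psi>. fip \<Psi> \<and> \<Phi> \<subseteq> \<Psi>}. \<forall>X\<in>{\<Psi>. fip \<Psi> \<and> \<Phi> \<subseteq> \<Psi>}. p \<subseteq> X \<longrightarrow> X = p"
  proof (rule subset_Zorn_nonempty)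
    show "{\<Psi>. fip \<Psi> \<and> \<Phi> \<subseteq> \<Psi>} \<noteq> {}" using assms by blast
    fix \<C> assume *: "\<C> \<noteq> {}" "subset.chain {\<Psi>. fip \<Psi> \<and> \<Phi> \<subseteq> \<Psi>} \<C>"
    then have "fip (\<Union>\<C>)"
      by (intro fip_chain_Union) (auto simp: subset.chain_def)
    moreover have "\<Phi> \<subseteq> \<Union>\<C>" using * unfolding subset.chain_def by blast
    ultimately show "\<Union>\<C> \<in> {\<Psi>. fip \<Psi> \<and> \<Phi> \<subseteq> \<Psi>}" by simp
  qed
  then obtain p where p: "fip p" "\<Phi> \<subseteq> p" and
    max: "\<And>X. fip X \<Longrightarrow> p \<subseteq> X \<Longrightarrow> X = p"
    by (auto intro: order_trans)
  \<comment> \<open>By maximality \<open>insert A p\<close> fails \<open>fip\<close>; removing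
    \<open>A\<close> from the finite set that shows this leaves a finite part of \<open>p\<close>
    whose intersection misses \<open>A\<close>.\<close>
  have wit: "\<exists>F. finite F \<and> F \<subseteq> p \<and> \<Inter>F \<inter> A = {}" if "A \<notin> p" for A
  proof -
    have "\<not> fip (insert A p)" using max[of "insert A p"] that by auto
    then obtain F where F: "finite F" "F \<subseteq> insert A p" "\<Inter>F = {}" by (auto simp: fip_def)
    then have "finite (F - {A})" "F - {A} \<subseteq> p" "\<Inter>(F - {A}) \<inter> A = {}" by auto
    then show ?thesis by blast
  qed
  have "A \<in> p \<or> - A \<in> p" for A
  proof (rule ccontr)
    assume "\<not> (A \<in> p \<or> - A \<in> p)"
    then obtain F G where "finite F" "F \<subseteq> p" "\<Inter>F \<inter> A = {}" "finite G" "G \<subseteq> p" "\<Inter>G \<inter> - A = {}"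
      using wit[of A] wit[of "- A"] by blast
    then have "finite (F \<union> G)" "F \<union> G \<subseteq> p" "\<Inter>(F \<union> G) = {}"
      unfolding Inter_Un_distrib by blast+
    then show False using p(1) unfolding fip_def by blast
  qed
  then have "p \<in> beta" using p(1) by (rule betaI[rotated])
  then show ?thesis using that p(2) by (simp add: ultrafilters_above_def)
qed

section \<open>Idempotents in closed subsemigroups\<close>

lemma left_quotient_Int [simp]:
  "left_quotient x (A \<inter> B) = left_quotient x A \<inter> left_quotient x B"
  and left_quotient_Compl [simp]: "left_quotient x (- A) = - left_quotient x A"
  and left_quotient_left_quotient:
    "left_quotient y (left_quotient x A) = left_quotient (x * y) A"
  by (auto simp: left_quotient_def mult.assoc)

lemma left_quotient_mono: "A \<subseteq> B \<Longrightarrow> left_quotient x A \<subseteq> left_quotient x B"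
  by (auto simp: left_quotient_def)

lemma mem_beta_mult: "A \<in> p \<odot> q \<longleftrightarrow> {x. left_quotient x A \<in> q} \<in> p"
  by (simp add: beta_mult_def)

lemma beta_mult_assoc: "(p \<odot> q) \<odot> r = p \<odot> (q \<odot> r)"
proof -
  have "left_quotient x {y. left_quotient y A \<in> r} = {y. left_quotient y (left_quotient x A) \<in> r}"
    for x A
    unfolding left_quotient_left_quotient by (simp add: left_quotient_def)
  then show ?thesis by (auto simp: mem_beta_mult)
qed

lemma beta_mult_in_beta:
  assumes p: "p \<in> beta" and q: "q \<in> beta"
  shows "p \<odot> q \<in> beta"
proof -
  have e: "left_quotient x UNIV = UNIV" "left_quotient x {} = {}" for x :: 'a
    by (auto simp: left_quotient_def)
  have "A \<inter> B \<in> p \<odot> q" if "A \<in> p \<odot> q" "B \<in> p \<odot> q" for A B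
    using beta_Int[OF p that[unfolded mem_beta_mult]] unfolding mem_beta_mult
    by (rule beta_mono[OF p]) (auto intro: beta_Int[OF q])
  moreover have "B \<in> p \<odot> q" if "A \<in> p \<odot> q" "A \<subseteq> B" for A B
    using that(1) unfolding mem_beta_mult
    by (rule beta_mono[OF p]) (use that(2) beta_mono[OF q] left_quotient_mono in blast)
  moreover have "A \<in> p \<odot> q \<or> - A \<in> p \<odot> q" for A
    using beta_Compl[OF p, of "{x. left_quotient x A \<in> q}"]
    by (simp add: mem_beta_mult beta_Compl[OF q] Collect_neg_eq)
  moreover have "UNIV \<in> p \<odot> q" "{} \<notin> p \<odot> q"
    by (simp_all add: mem_beta_mult e beta_UNIV[OF p] beta_UNIV[OF q] beta_empty[OF p] beta_empty[OF q])
  ultimately show ?thesis unfolding beta_def ultrafilter_def by blast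
qed

text \<open>Fibres of \<open>q \<mapsto> q \<odot> p\<close> are closed: ultrafilters are maximal,
  so the equation amounts to \<open>r \<subseteq> q \<odot> p\<close>, which only lists sets that
  \<open>q\<close> must contain.\<close>

lemma ultrafilters_above_mult_eq:
  assumes p: "p \<in> beta" and r: "r \<in> beta"
  shows "{q \<in> beta. q \<odot> p = r} = ultrafilters_above ((\<lambda>A. {x. left_quotient x A \<in> p}) ` r)"
proof -
  have "q \<odot> p = r \<longleftrightarrow> r \<subseteq> q \<odot> p" if "q \<in> beta" for q
    using beta_eqI[OF r beta_mult_in_beta[OF that p]] by auto
  then show ?thesis
    by (auto simp: ultrafilters_above_def subset_eq mem_beta_mult)
qed

text \<open>The image of a closed set under the continuous map \<open>q \<mapsto> q \<odot> p\<close> is closed.\<close>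

lemma ultrafilters_above_image_mult:
  assumes p: "p \<in> beta"
  shows "ultrafilters_above (\<Inter>q\<in>ultrafilters_above \<Phi>. q \<odot> p) = (\<lambda>q. q \<odot> p) ` ultrafilters_above \<Phi>"
    (is "ultrafilters_above ?\<Psi> = _")
proof (intro equalityI subsetI)
  fix r assume "r \<in> ultrafilters_above ?\<Psi>"
  then have r: "r \<in> beta" and sub: "?\<Psi> \<subseteq> r" by (auto simp: ultrafilters_above_def)
  let ?R = "\<lambda>A. {x. left_quotient x A \<in> p}"
  \<comment> \<open>An ultrafilter containing this union lies above \<open>\<Phi>\<close> and is
    mapped to \<open>r\<close>.\<close>
  have "fip (\<Phi> \<union> ?R ` r)"
    unfolding fip_def
  proof (intro allI impI notI)
    fix G assume G: "finite G" "G \<subseteq> \<Phi> \<union> ?R ` r" "\<Inter>G = {}"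
    have "finite (G - \<Phi>)" "G - \<Phi> \<subseteq> ?R ` r" using G by auto
    then obtain r' where r': "finite r'" "r' \<subseteq> r" "G - \<Phi> = ?R ` r'"
      by (meson finite_subset_image)
    \<comment> \<open>Otherwise \<open>q\<close> would contain all of \<open>G\<close>, whose
      intersection is empty. So \<open>- \<Inter>r'\<close> lies in every
      \<open>q \<odot> p\<close>, hence in \<open>?\<Psi>\<close>.\<close>
    have "- \<Inter>r' \<in> q \<odot> p" if q: "q \<in> ultrafilters_above \<Phi>" for q
    proof (rule ccontr)
      have qb: "q \<in> beta" "\<Phi> \<subseteq> q" using q by (auto simp: ultrafilters_above_def)
      have qp: "q \<odot> p \<in> beta" using beta_mult_in_beta[OF qb(1) p] .
      assume "- \<Inter>r' \<notin> q \<odot> p"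
      then have "\<Inter>r' \<in> q \<odot> p" by (simp add: beta_Compl[OF qp])
      then have "\<forall>B\<in>r'. B \<in> q \<odot> p" using beta_mono[OF qp] by blast
      then have "?R ` r' \<subseteq> q" by (auto simp: mem_beta_mult)
      then have "G \<subseteq> q" using r'(3)[symmetric] qb(2) by auto
      then have "\<Inter>G \<in> q" using beta_Inter[OF qb(1) G(1)] by simp
      then show False using G(3) beta_empty[OF qb(1)] by simp
    qed
    then have "- \<Inter>r' \<in> r" using sub by auto
    then show False using beta_Inter[OF r r'(1,2)] beta_Compl[OF r] by blast
  qed
  then obtain q where "q \<in> ultrafilters_above (\<Phi> \<union> ?R ` r)" by (rule ex_ultrafilter_above)
  then have "q \<in> ultrafilters_above \<Phi>" "q \<odot> p = r"
    using ultrafilters_above_mult_eq[OF p r] by (auto simp: ultrafilters_above_def)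
  then show "r \<in> (\<lambda>q. q \<odot> p) ` ultrafilters_above \<Phi>" by blast
next
  fix r assume "r \<in> (\<lambda>q. q \<odot> p) ` ultrafilters_above \<Phi>"
  then show "r \<in> ultrafilters_above ?\<Psi>"
    by (auto simp: ultrafilters_above_def intro: beta_mult_in_beta p)
qed

text \<open>Minimal closed subsemigroups correspond to maximal sets \<open>\<Phi>\<close>.\<close>

theorem Ellis_Numakura:
  fixes \<Phi> :: "'a::semigroup_mult set set"
  assumes "beta_subsemigroup (ultrafilters_above \<Phi>)"
  obtains p where "p \<in> ultrafilters_above \<Phi>" "p \<odot> p = p"
proof -
  let ?Z = "{\<Psi>. beta_subsemigroup (ultrafilters_above \<Psi>) \<and> \<Phi> \<subseteq> \<Psi>}"
  have "\<exists>M\<in>?Z. \<forall>X\<in>?Z. M \<subseteq> X \<longrightarrow> X = M"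
  proof (rule subset_Zorn_nonempty)
    show "?Z \<noteq> {}" using assms by blast
    fix \<C> assume *: "\<C> \<noteq> {}" "subset.chain ?Z \<C>"
    then have Z: "beta_subsemigroup (ultrafilters_above \<Psi>)" "\<Phi> \<subseteq> \<Psi>" if "\<Psi> \<in> \<C>" for \<Psi>
      using that by (auto simp: subset.chain_def)
    have "fip \<Psi>" if \<Psi>: "\<Psi> \<in> \<C>" for \<Psi>
    proof -
      obtain p where "p \<in> beta" "\<Psi> \<subseteq> p"
        using Z(1)[OF \<Psi>] unfolding beta_subsemigroup_def ultrafilters_above_def by auto
      then show ?thesis using fip_mono fip_beta by blast
    qed
    \<comment> \<open>Compactness: the intersection of the closed subsemigroups along the chain
      stays non-empty.\<close>
    then have "fip (\<Union>\<C>)" using *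
      by (intro fip_chain_Union) (auto simp: subset.chain_def)
    then obtain p where "p \<in> ultrafilters_above (\<Union>\<C>)" by (rule ex_ultrafilter_above)
    moreover have "ultrafilters_above (\<Union>\<C>) = (\<Inter>\<Psi>\<in>\<C>. ultrafilters_above \<Psi>)"
      using *(1) by (auto simp: ultrafilters_above_def)
    ultimately have "beta_subsemigroup (ultrafilters_above (\<Union>\<C>))"
      using Z(1) *(1) by (auto simp: beta_subsemigroup_def ultrafilters_above_def)
    then show "\<Union>\<C> \<in> ?Z" using Z(2) *(1) by blast
  qed
  then obtain M where M: "beta_subsemigroup (ultrafilters_above M)" "\<Phi> \<subseteq> M"
    and max: "\<And>X. beta_subsemigroup (ultrafilters_above X) \<Longrightarrow> M \<subseteq> X \<Longrightarrow> X = M"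
    by (auto intro: order_trans)
  obtain p where p: "p \<in> ultrafilters_above M"
    using M(1) by (auto simp: beta_subsemigroup_def)
  have pb: "p \<in> beta" using p by (simp add: ultrafilters_above_def)
  have mult: "q \<odot> r \<in> ultrafilters_above M"
    if "q \<in> ultrafilters_above M" "r \<in> ultrafilters_above M" for q r
    using M(1) that by (simp add: beta_subsemigroup_def)
  \<comment> \<open>\<open>?\<Psi>\<close> codes the closed set of all \<open>q \<odot> p\<close>
    with \<open>q\<close> above \<open>M\<close>. It is a subsemigroup inside the minimal one, so
    the two coincide and \<open>p\<close> itself has the form \<open>q \<odot> p\<close>.\<close>
  let ?\<Psi> = "\<Inter>q\<in>ultrafilters_above M. q \<odot> p"
  have "beta_subsemigroup (ultrafilters_above ?\<Psi>)"
    using p mult beta_mult_in_beta pb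
    unfolding ultrafilters_above_image_mult[OF pb] beta_subsemigroup_def
    by (auto simp: beta_mult_assoc[symmetric] ultrafilters_above_def[of M])
  moreover have "M \<subseteq> ?\<Psi>"
    using mult[OF _ p] by (auto simp: ultrafilters_above_def)
  ultimately have "?\<Psi> = M" by (rule max)
  then have "p \<in> (\<lambda>q. q \<odot> p) ` ultrafilters_above M"
    using ultrafilters_above_image_mult[OF pb, of M] p by simp
  then obtain q where q: "q \<in> ultrafilters_above M" "q \<odot> p = p" by force
  \<comment> \<open>\<open>?N\<close> codes the \<open>q\<close> above \<open>M\<close> with
    \<open>q \<odot> p = p\<close>, again a closed subsemigroup; by minimality \<open>p\<close> is
    one of these \<open>q\<close>.\<close>
  let ?N = "M \<union> (\<lambda>A. {x. left_quotient x A \<in> p}) ` p"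
  have N: "ultrafilters_above ?N = {q \<in> ultrafilters_above M. q \<odot> p = p}"
    using ultrafilters_above_mult_eq[OF pb pb] by (auto simp: ultrafilters_above_def)
  have "beta_subsemigroup (ultrafilters_above ?N)"
    unfolding N beta_subsemigroup_def using q mult
    by (auto simp: beta_mult_assoc) (auto simp: ultrafilters_above_def)
  then have "?N = M" by (rule max) auto
  then have "p \<odot> p = p" using N p by auto
  then show ?thesis using that p M(2) by (auto simp: ultrafilters_above_def)
qed

section \<open>From directed families to idempotents\<close>

lemma ramsey_finite_Union:
  assumes "is_family \<F>" "ramsey_property \<F>" "finite G" "G \<inter> \<F> = {}"
  shows "\<Union>G \<notin> \<F>"
  using assms(3,4)
proof (induction G rule: finite_induct)
  case empty
  then show ?case using assms(1) by (simp add: is_family_def)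
next
  case (insert A G)
  then have "A \<notin> \<F>" "\<Union>G \<notin> \<F>" by auto
  then show ?case using assms(2) unfolding ramsey_property_def by (metis Union_insert)
qed

lemma beta_of_eq:
  assumes "is_family \<F>" "ramsey_property \<F>"
  shows "beta_of \<F> = ultrafilters_above (uminus ` (- \<F>))"
proof -
  have "p \<subseteq> \<F> \<longleftrightarrow> uminus ` (- \<F>) \<subseteq> p" if "p \<in> beta" for p
    using beta_Compl[OF that] by blast
  then show ?thesis by (auto simp: beta_of_def ultrafilters_above_def)
qed

text \<open>If the property failed, a finite intersection of sets from \<open>\<C>\<close>, which is
  an \<open>\<F>\<close>-set, would be covered by finitely many sets outside \<open>\<F>\<close>,
  against the Ramsey property.\<close>

lemma fip_ramsey:
  assumes fam: "is_family \<F>" and ram: "ramsey_property \<F>"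
    and \<C>: "\<And>H. H \<noteq> {} \<Longrightarrow> finite H \<Longrightarrow> H \<subseteq> \<C> \<Longrightarrow> \<Inter>H \<in> \<F>"
  shows "fip (uminus ` (- \<F>) \<union> \<C>)"
  unfolding fip_def
proof (intro allI impI notI)
  fix G assume G: "finite G" "G \<subseteq> uminus ` (- \<F>) \<union> \<C>" "\<Inter>G = {}"
  have up: "B \<in> \<F>" if "A \<in> \<F>" "A \<subseteq> B" for A B
    using fam that unfolding is_family_def by blast
  have "UNIV \<in> \<F>" using fam up unfolding is_family_def by blast
  \<comment> \<open>If \<open>G\<close> contains no set from \<open>\<C>\<close>, the intersection
    is \<open>UNIV\<close>.\<close>
  then have "\<Inter>(G \<inter> \<C>) \<in> \<F>" using \<C>[of "G \<inter> \<C>"] G(1) by (cases "G \<inter> \<C> = {}") auto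
  moreover have "\<Inter>(G \<inter> \<C>) \<subseteq> \<Union>(uminus ` (G - \<C>))" using G(3) by auto
  ultimately have "\<Union>(uminus ` (G - \<C>)) \<in> \<F>" by (rule up)
  moreover have "uminus ` (G - \<C>) \<inter> \<F> = {}" using G(2) by auto
  ultimately show False using ramsey_finite_Union[OF fam ram, of "uminus ` (G - \<C>)"] G(1) by simp
qed

lemma directed_imp_essential:
  assumes fam: "is_family \<F>" and ram: "ramsey_property \<F>"
    and semi: "beta_subsemigroup (beta_of \<F>)" and dir: "directed_condition \<F> A I C"
  shows "essential_set \<F> A"
proof -
  let ?\<Phi> = "uminus ` (- \<F>) \<union> C ` I"
  have I: "I \<noteq> {}" and sub: "\<And>F. F \<in> I \<Longrightarrow> C F \<subseteq> A"
    and shift: "\<And>F x. F \<in> I \<Longrightarrow> x \<in> C F \<Longrightarrow> \<exists>G\<in>I. C G \<subseteq> left_quotient x (C F)"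
    and fin: "\<And>H. H \<noteq> {} \<Longrightarrow> finite H \<Longrightarrow> H \<subseteq> I \<Longrightarrow> (\<Inter>F\<in>H. C F) \<in> \<F>"
    using dir unfolding directed_condition_def downward_directed_def by blast+
  have above: "ultrafilters_above ?\<Phi> = {p \<in> beta_of \<F>. C ` I \<subseteq> p}"
    unfolding beta_of_eq[OF fam ram] by (simp add: ultrafilters_above_def conj_assoc)
  have "fip ?\<Phi>"
  proof (rule fip_ramsey[OF fam ram])
    fix H assume "H \<noteq> {}" "finite H" "H \<subseteq> C ` I"
    then obtain H' where "H' \<subseteq> I" "finite H'" "H = C ` H'" by (meson finite_subset_image)
    then show "\<Inter>H \<in> \<F>" using fin[of H'] \<open>H \<noteq> {}\<close> by auto
  qed
  then obtain p where p: "p \<in> ultrafilters_above ?\<Phi>" by (rule ex_ultrafilter_above)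
  have "q \<odot> r \<in> ultrafilters_above ?\<Phi>"
    if q: "q \<in> ultrafilters_above ?\<Phi>" and r: "r \<in> ultrafilters_above ?\<Phi>" for q r
  proof -
    have qb: "q \<in> beta" "C ` I \<subseteq> q" and rb: "r \<in> beta" "C ` I \<subseteq> r"
      using q r by (auto simp: ultrafilters_above_def)
    have "C F \<in> q \<odot> r" if F: "F \<in> I" for F
    proof -
      \<comment> \<open>The quotient includes some \<open>C G\<close>, which lies in
        \<open>r\<close>. So the set tested by \<open>mem_beta_mult\<close> includes
        \<open>C F\<close>, a member of \<open>q\<close>.\<close>
      have "C F \<subseteq> {x. left_quotient x (C F) \<in> r}"
      proof
        fix x assume "x \<in> C F"
        then obtain G where "G \<in> I" "C G \<subseteq> left_quotient x (C F)" using shift[OF F] by blast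
        then show "x \<in> {x. left_quotient x (C F) \<in> r}" using rb(2) beta_mono[OF rb(1)] by blast
      qed
      then show ?thesis unfolding mem_beta_mult using beta_mono[OF qb(1)] qb(2) F by blast
    qed
    moreover have "q \<odot> r \<in> beta_of \<F>"
      using q r semi unfolding above beta_subsemigroup_def by auto
    ultimately show ?thesis unfolding above by blast
  qed
  then have "beta_subsemigroup (ultrafilters_above ?\<Phi>)"
    using p unfolding beta_subsemigroup_def by (auto simp: ultrafilters_above_def)
  then obtain e where e: "e \<in> ultrafilters_above ?\<Phi>" "e \<odot> e = e" by (rule Ellis_Numakura)
  obtain F where F: "F \<in> I" using I by blast
  have "e \<in> beta_of \<F>" "C F \<in> e" using e(1) F unfolding above by auto
  moreover from this have "A \<in> e"
    using beta_mono[of e "C F" A] sub[OF F] by (simp add: beta_of_def)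
  ultimately show ?thesis using e(2) unfolding essential_set_def by blast
qed

section \<open>Sequences and trees as directed families\<close>

lemma sequence_imp_directed:
  assumes "sequence_condition \<F> A C"
  shows "directed_condition \<F> A {1..} C"
proof -
  have anti: "C n \<subseteq> C m" if "1 \<le> m" "m \<le> n" for m n
    using assms that by (auto simp: sequence_condition_def monotone_on_def)
  have "\<exists>H\<in>{1..}. C H \<subseteq> C F \<inter> C G" if "F \<in> {1..}" "G \<in> {1..}" for F G
    using that anti[of F "max F G"] anti[of G "max F G"] by (intro bexI[of _ "max F G"]) auto
  moreover have "(\<Inter>n\<in>H. C n) \<in> \<F>" if H: "H \<noteq> {}" "finite H" "H \<subseteq> {1..}" for H
  proof -
    \<comment> \<open>The term of largest index is the smallest, hence the whole
      intersection.\<close>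
    have "Max H \<in> H" using H by simp
    moreover from this have "1 \<le> Max H" using H(3) by auto
    moreover have "C (Max H) \<subseteq> C n" if "n \<in> H" for n
      using that H by (intro anti) auto
    ultimately have "(\<Inter>n\<in>H. C n) = C (Max H)" by blast
    then show ?thesis using \<open>1 \<le> Max H\<close> assms by (simp add: sequence_condition_def)
  qed
  ultimately show ?thesis
    using assms unfolding directed_condition_def downward_directed_def sequence_condition_def
    by (auto simp: Bex_def)
qed

lemma tree_branch_subset:
  assumes T: "tree_condition \<F> A T" and f: "f \<in> T"
  shows "branch T f \<subseteq> A"
proof
  fix x assume "x \<in> branch T f"
  then have "extend f x \<in> T" by (simp add: branch_def)
  then have "ran (extend f x) \<subseteq> A" using T by (auto simp: tree_condition_def)
  moreover have "x \<in> ran (extend f x)"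
    unfolding extend_def by (auto intro: ranI[where a = "card (dom f)"])
  ultimately show "x \<in> A" by blast
qed

lemma tree_Inter_branch:
  assumes "tree_condition \<F> A T" "F \<noteq> {}" "finite F" "F \<subseteq> T"
  shows "(\<Inter>f\<in>F. branch T f) \<in> \<F>"
  using assms unfolding tree_condition_def by (elim conjE) simp

text \<open>Indices are finite sets of nodes, so that intersecting members of the family amounts to
  uniting their indices.\<close>

lemma tree_imp_directed:
  assumes T: "tree_condition \<F> A T"
  shows "directed_condition \<F> A {F. F \<noteq> {} \<and> finite F \<and> F \<subseteq> T} (\<lambda>F. \<Inter>f\<in>F. branch T f)"
    (is "directed_condition _ _ ?I ?C")
  unfolding directed_condition_def downward_directed_def
proof (intro conjI ballI allI impI)
  obtain f where f: "f \<in> T" using T by (auto simp: tree_condition_def)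
  show "?I \<noteq> {}" using f by (auto intro: exI[of _ "{f}"])
  show "\<exists>H\<in>?I. ?C H \<subseteq> ?C F \<inter> ?C G" if "F \<in> ?I" "G \<in> ?I" for F G
    using that by (intro bexI[of _ "F \<union> G"]) auto
  show "?C F \<subseteq> A" if "F \<in> ?I" for F
    using that tree_branch_subset[OF T] by blast
  show "\<exists>G\<in>?I. ?C G \<subseteq> left_quotient x (?C F)" if F: "F \<in> ?I" and x: "x \<in> ?C F" for F x
  proof
    \<comment> \<open>The index sought is \<open>F\<close> with every node prolonged by
      \<open>x\<close>.\<close>
    have "extend f x \<in> T" if "f \<in> F" for f using x that by (auto simp: branch_def)
    then show "(\<lambda>f. extend f x) ` F \<in> ?I" using F by auto
    have "branch T (extend f x) \<subseteq> left_quotient x (branch T f)" if "f \<in> F" for f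
      using T F x that unfolding tree_condition_def by blast
    then show "?C ((\<lambda>f. extend f x) ` F) \<subseteq> left_quotient x (?C F)"
      unfolding left_quotient_def by blast
  qed
  show "(\<Inter>F\<in>H. ?C F) \<in> \<F>" if H: "H \<noteq> {}" "finite H" "H \<subseteq> ?I" for H
  proof -
    have "\<Union>H \<noteq> {}" "finite (\<Union>H)" "\<Union>H \<subseteq> T" using H by auto
    then have "?C (\<Union>H) \<in> \<F>" by (rule tree_Inter_branch[OF T])
    moreover have "?C (\<Union>H) = (\<Inter>F\<in>H. ?C F)" by blast
    ultimately show ?thesis by simp
  qed
qed

section \<open>From idempotents to trees, families and sequences\<close>

text \<open>In the usual notation \<open>B* = {x \<in> B. left_quotient x B \<in> p}\<close>, this
  says that \<open>B \<in> p\<close> and \<open>B* = B\<close>.\<close>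

definition star_closed :: "'a::semigroup_mult set set \<Rightarrow> 'a set \<Rightarrow> bool" where
  "star_closed p B \<longleftrightarrow> B \<in> p \<and> (\<forall>x\<in>B. left_quotient x B \<in> p)"

text \<open>The set \<open>A*\<close> works: idempotence of \<open>p\<close> makes \<open>?R\<close>
  map \<open>p\<close> into itself, and \<open>?R\<close> commutes with
  \<open>left_quotient x\<close>.\<close>

lemma ex_star_closed:
  assumes p: "p \<in> beta" "p \<odot> p = p" and A: "A \<in> p"
  obtains B where "B \<subseteq> A" "star_closed p B"
proof
  let ?R = "\<lambda>A. {x. left_quotient x A \<in> p}"
  let ?B = "A \<inter> ?R A"
  have R: "?R A \<in> p" if "A \<in> p" for A using that p(2) mem_beta_mult by metis
  show "?B \<subseteq> A" by blast
  have "left_quotient x ?B \<in> p" if "x \<in> ?B" for x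
  proof -
    have "left_quotient x (?R A) = ?R (left_quotient x A)"
      by (auto simp: left_quotient_left_quotient) (auto simp: left_quotient_def)
    then show ?thesis using that by (auto intro!: beta_Int[OF p(1)] R)
  qed
  then show "star_closed p ?B"
    using beta_Int[OF p(1) A R[OF A]] by (simp add: star_closed_def)
qed

lemma star_closed_Int:
  assumes "p \<in> beta" "star_closed p B" "star_closed p C"
  shows "star_closed p (B \<inter> C)"
  using assms by (auto simp: star_closed_def intro: beta_Int)

text \<open>Quotients compose: if \<open>y \<in> left_quotient x B\<close>, then
  \<open>x * y \<in> B\<close>, so the quotient of \<open>B\<close> by \<open>x * y\<close> is in
  \<open>p\<close>.\<close>

lemma star_closed_Int_left_quotient:
  assumes p: "p \<in> beta" and B: "star_closed p B" and x: "x \<in> B"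
  shows "star_closed p (B \<inter> left_quotient x B)"
proof -
  have "left_quotient y (left_quotient x B) \<in> p" if "y \<in> left_quotient x B" for y
    using that B unfolding left_quotient_left_quotient
    by (auto simp: star_closed_def left_quotient_def)
  then show ?thesis using assms by (auto simp: star_closed_def intro: beta_Int)
qed

lemma essential_imp_directed:
  assumes "essential_set \<F> A"
  shows "\<exists>I. directed_condition \<F> A I (\<lambda>B. B)"
proof -
  obtain p where pF: "p \<in> beta_of \<F>" and id: "p \<odot> p = p" and A: "A \<in> p"
    using assms by (auto simp: essential_set_def)
  have p: "p \<in> beta" "p \<subseteq> \<F>" using pF by (auto simp: beta_of_def)
  let ?I = "{B. B \<subseteq> A \<and> star_closed p B}"
  have "directed_condition \<F> A ?I (\<lambda>B. B)"
    unfolding directed_condition_def downward_directed_def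
  proof (intro conjI ballI allI impI)
    show "?I \<noteq> {}" using ex_star_closed[OF p(1) id A] by blast
    show "\<exists>H\<in>?I. H \<subseteq> F \<inter> G" if "F \<in> ?I" "G \<in> ?I" for F G
      using that star_closed_Int[OF p(1)] by (intro bexI[of _ "F \<inter> G"]) auto
    show "\<exists>G\<in>?I. G \<subseteq> left_quotient x F" if "F \<in> ?I" "x \<in> F" for F x
      using that star_closed_Int_left_quotient[OF p(1)]
      by (intro bexI[of _ "F \<inter> left_quotient x F"]) auto
    show "F \<subseteq> A" if "F \<in> ?I" for F
      using that by blast
    show "(\<Inter>F\<in>H. F) \<in> \<F>" if "finite H" "H \<subseteq> ?I" for H
      using beta_Inter[OF p(1), of H] p(2) that by (auto simp: star_closed_def)
  qed
  then show ?thesis by blast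
qed

section \<open>The tree of an idempotent\<close>

text \<open>The set of admissible values at position \<open>n\<close> of a node whose first \<open>n\<close> values are those of \<open>f\<close>.\<close>

primrec successors :: "'a::semigroup_mult set \<Rightarrow> (nat \<rightharpoonup> 'a) \<Rightarrow> nat \<Rightarrow> 'a set" where
  "successors B f 0 = B"
| "successors B f (Suc n) = successors B f n \<inter> left_quotient (the (f n)) (successors B f n)"

text \<open>Only values \<open>f i\<close> with \<open>i < n\<close> are read, all inside the
  domain, so \<open>the\<close> never meets \<open>None\<close>.\<close>

definition successor_tree :: "'a::semigroup_mult set \<Rightarrow> (nat \<rightharpoonup> 'a) set" where
  "successor_tree B = {f. \<exists>n. dom f = {..<n} \<and> (\<forall>i<n. the (f i) \<in> successors B f i)}"

lemma successors_subset: "successors B f n \<subseteq> B"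
  by (induction n) auto

text \<open>Stage \<open>i\<close> reads \<open>f\<close> only at positions below \<open>i\<close>,
  so position \<open>n\<close> may be overwritten even when \<open>i = n\<close>.\<close>

lemma successors_upd: "i \<le> n \<Longrightarrow> successors B (f(n \<mapsto> x)) i = successors B f i"
  by (induction i) auto

text \<open>Extending \<open>f\<close> keeps its old constraints and adds a single one, at position
  \<open>n\<close>.\<close>

lemma branch_successor_tree:
  assumes f: "f \<in> successor_tree B" and dom: "dom f = {..<n}"
  shows "branch (successor_tree B) f = successors B f n"
proof -
  have "the (f i) \<in> successors B f i" if "i < n" for i
    using f dom that by (auto simp: successor_tree_def)
  moreover have "dom (f(n \<mapsto> x)) = {..<Suc n}" for x using dom by auto
  \<comment> \<open>The domain determines the length quantified in
    \<open>successor_tree\<close>.\<close>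
  moreover have "{..<Suc n} = {..<m} \<longleftrightarrow> m = Suc n" for m by auto
  ultimately show ?thesis
    by (auto simp: branch_def extend_def dom successor_tree_def successors_upd less_Suc_eq
        simp del: dom_fun_upd)
qed

lemma successors_star_closed:
  assumes "p \<in> beta" "star_closed p B" "\<forall>i<n. the (f i) \<in> successors B f i"
  shows "star_closed p (successors B f n)"
  using assms(3)
  by (induction n) (auto intro: assms star_closed_Int_left_quotient)

lemma essential_imp_tree:
  assumes "essential_set \<F> A"
  shows "\<exists>T. tree_condition \<F> A T"
proof -
  obtain p where pF: "p \<in> beta_of \<F>" and id: "p \<odot> p = p" and A: "A \<in> p"
    using assms by (auto simp: essential_set_def)
  have p: "p \<in> beta" "p \<subseteq> \<F>" using pF by (auto simp: beta_of_def)
  obtain B where B: "B \<subseteq> A" "star_closed p B" using ex_star_closed[OF p(1) id A] .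
  let ?T = "successor_tree B"
  have "tree_condition \<F> A ?T"
    unfolding tree_condition_def
  proof (intro conjI ballI allI impI)
    have "Map.empty \<in> ?T" by (auto simp: successor_tree_def)
    then show "?T \<noteq> {}" by blast
    show "\<exists>n. dom f = {..<n}" if "f \<in> ?T" for f
      using that by (auto simp: successor_tree_def)
    show "ran f \<subseteq> A" if f: "f \<in> ?T" for f
    proof -
      obtain n where n: "dom f = {..<n}" "\<forall>i<n. the (f i) \<in> successors B f i"
        using f by (auto simp: successor_tree_def)
      have "y \<in> A" if "f i = Some y" for i y
      proof -
        have "i < n" using that n(1) by auto
        then show ?thesis using n(2) that successors_subset[of B f i] B(1) by fastforce
      qed
      then show ?thesis by (auto simp: ran_def)
    qed
    show "branch ?T (extend f x) \<subseteq> left_quotient x (branch ?T f)"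
      if f: "f \<in> ?T" and x: "x \<in> branch ?T f" for f x
    proof -
      obtain n where n: "dom f = {..<n}" using f by (auto simp: successor_tree_def)
      have e: "extend f x = f(n \<mapsto> x)" by (simp add: extend_def n)
      have "extend f x \<in> ?T" using x by (simp add: branch_def)
      moreover have "dom (extend f x) = {..<Suc n}" using n by (auto simp: e)
      ultimately have "branch ?T (extend f x) = successors B (extend f x) (Suc n)"
        by (rule branch_successor_tree)
      \<comment> \<open>The recursion at \<open>Suc n\<close> takes the quotient by the value at
        position \<open>n\<close>, which is \<open>x\<close>.\<close>
      also have "\<dots> \<subseteq> left_quotient x (successors B f n)" by (simp add: e successors_upd)
      finally show ?thesis by (simp add: branch_successor_tree[OF f n])
    qed
    show "(\<Inter>f\<in>F. branch ?T f) \<in> \<F>" if F: "finite F" "F \<subseteq> ?T" for F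
    proof -
      have "branch ?T f \<in> p" if "f \<in> F" for f
      proof -
        have f: "f \<in> ?T" using that F(2) by blast
        then obtain n where n: "dom f = {..<n}" "\<forall>i<n. the (f i) \<in> successors B f i"
          by (auto simp: successor_tree_def)
        show ?thesis
          using successors_star_closed[OF p(1) B(2) n(2)] branch_successor_tree[OF f n(1)]
          by (simp add: star_closed_def)
      qed
      then have "(\<Inter>f\<in>F. branch ?T f) \<in> p"
        using beta_Inter[OF p(1), of "branch ?T ` F"] F(1) by auto
      then show ?thesis using p(2) by (rule subsetD[rotated])
    qed
  qed
  then show ?thesis by blast
qed

section \<open>Countable trees and decreasing sequences\<close>

lemma countable_initial_segment_maps:
  assumes "countable (UNIV :: 'a set)"
  shows "countable {f :: nat \<rightharpoonup> 'a. \<exists>n. dom f = {..<n}}"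
proof -
  \<comment> \<open>Maps on initial segments are coded by the finite lists of their values.\<close>
  have "countable (UNIV :: 'a list set)"
    using countable_lists[OF assms] by simp
  then have "countable (range (\<lambda>(xs :: 'a list) i. if i < length xs then Some (xs ! i) else None))"
    by (rule countable_image)
  moreover have "f \<in> range (\<lambda>xs i. if i < length xs then Some (xs ! i) else None)"
    if "dom f = {..<n}" for f :: "nat \<rightharpoonup> 'a" and n
  proof (rule range_eqI[where x = "map (the \<circ> f) [0..<n]"], rule ext)
    fix i
    have "f i = None \<longleftrightarrow> \<not> i < n" using that by (metis domIff lessThan_iff)
    then show "f i = (if i < length (map (the \<circ> f) [0..<n]) then Some (map (the \<circ> f) [0..<n] ! i)
        else None)"
      by auto
  qed
  ultimately show ?thesis by (elim countable_subset[rotated]) blast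
qed

lemma countable_tree_imp_sequence:
  assumes T: "tree_condition \<F> A T" and "countable T"
  shows "\<exists>C. sequence_condition \<F> A C"
proof -
  \<comment> \<open>An enumeration of \<open>T\<close>, with repetitions if \<open>T\<close> is
    finite.\<close>
  define f where "f = from_nat_into T"
  have "T \<noteq> {}" using T by (simp add: tree_condition_def)
  then have ran: "range f = T" by (simp add: f_def assms(2))
  have fT: "f i \<in> T" for i using ran by blast
  define C where "C n = (\<Inter>i\<le>n. branch T (f i))" for n
  have "antimono_on {1..} C" by (force simp: monotone_on_def C_def)
  moreover have "C n \<subseteq> A" for n
    using tree_branch_subset[OF T fT[of 0]] by (auto simp: C_def)
  moreover have "\<exists>m\<ge>1. C m \<subseteq> left_quotient x (C n)" if x: "x \<in> C n" for n x
  proof -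
    have "\<exists>k. f k = extend (f i) x" if "i \<le> n" for i
    proof -
      have "extend (f i) x \<in> T" using x that by (auto simp: C_def branch_def)
      then show ?thesis using ran by (metis imageE)
    qed
    then obtain k where k: "\<And>i. i \<le> n \<Longrightarrow> f (k i) = extend (f i) x" by metis
    \<comment> \<open>By this stage the extensions by \<open>x\<close> of all nodes
      \<open>f 0\<close>, ..., \<open>f n\<close> have been enumerated; \<open>Suc\<close> ensures
      \<open>?m \<ge> 1\<close>.\<close>
    let ?m = "Suc (Max (k ` {..n}))"
    have "C ?m \<subseteq> left_quotient x (branch T (f i))" if i: "i \<le> n" for i
    proof -
      have "k i \<le> Max (k ` {..n})" using i by (intro Max_ge) auto
      then have "C ?m \<subseteq> branch T (extend (f i) x)"
        using k[OF i] unfolding C_def by (metis INF_lower atMost_iff le_SucI)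
      also have "\<dots> \<subseteq> left_quotient x (branch T (f i))"
        using T fT[of i] x i by (auto simp: tree_condition_def C_def)
      finally show ?thesis .
    qed
    then have "C ?m \<subseteq> left_quotient x (C n)" by (auto simp: C_def[of n] left_quotient_def)
    then show ?thesis by (intro exI[of _ ?m]) simp
  qed
  moreover have "C n \<in> \<F>" for n
  proof -
    have "f ` {..n} \<noteq> {}" "finite (f ` {..n})" "f ` {..n} \<subseteq> T" using fT by auto
    then have "(\<Inter>g\<in>f ` {..n}. branch T g) \<in> \<F>" by (rule tree_Inter_branch[OF T])
    then show ?thesis by (simp add: C_def)
  qed
  ultimately show ?thesis unfolding sequence_condition_def by blast
qed

text \<open>Trees and sequences become directed families indexed by finite sets of nodes and by
  positive integers, so \<open>directed_imp_essential\<close>, valid for any index type, yields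
  every implication into the first statement. In the countable case the sequence comes from the
  tree.\<close>

theorem theorem2p3:
  fixes \<F> :: "'a::semigroup_mult set set" and A :: "'a set"
  assumes "is_family \<F>"
    and "ramsey_property \<F>"
    and "beta_subsemigroup (beta_of \<F>)"
  shows "(essential_set \<F> A \<longleftrightarrow> (\<exists>T. tree_condition \<F> A T)) \<and>
    (essential_set \<F> A \<longleftrightarrow>
       (\<exists>(I :: 'a set set) (C :: 'a set \<Rightarrow> 'a set). directed_condition \<F> A I C)) \<and>
    ((\<exists>(I :: 'i set) (C :: 'i \<Rightarrow> 'a set). directed_condition \<F> A I C) \<longrightarrow> essential_set \<F> A) \<and>
    ((\<exists>C. sequence_condition \<F> A C) \<longrightarrow> essential_set \<F> A) \<and>
    (countable (UNIV :: 'a set) \<longrightarrow>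
       (essential_set \<F> A \<longleftrightarrow> (\<exists>C. sequence_condition \<F> A C)))"
proof (intro conjI impI)
  note ess = directed_imp_essential[OF assms]
  show tree: "essential_set \<F> A \<longleftrightarrow> (\<exists>T. tree_condition \<F> A T)"
    using essential_imp_tree ess[OF tree_imp_directed] by blast
  show "essential_set \<F> A \<longleftrightarrow>
      (\<exists>(I :: 'a set set) (C :: 'a set \<Rightarrow> 'a set). directed_condition \<F> A I C)"
    using essential_imp_directed ess by blast
  show "essential_set \<F> A"
    if "\<exists>(I :: 'i set) (C :: 'i \<Rightarrow> 'a set). directed_condition \<F> A I C"
    using that ess by blast
  show seq: "essential_set \<F> A" if "\<exists>C. sequence_condition \<F> A C"
    using that ess[OF sequence_imp_directed] by blast
  show "essential_set \<F> A \<longleftrightarrow> (\<exists>C. sequence_condition \<F> A C)" if "countable (UNIV :: 'a set)"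
  proof
    assume "essential_set \<F> A"
    then obtain T where T: "tree_condition \<F> A T" using tree by blast
    then have "T \<subseteq> {f. \<exists>n. dom f = {..<n}}" by (auto simp: tree_condition_def)
    then have "countable T"
      using countable_initial_segment_maps[OF that] by (rule countable_subset)
    then show "\<exists>C. sequence_condition \<F> A C" by (rule countable_tree_imp_sequence[OF T])
  qed (rule seq)
qed

end
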